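(* Let $k\ge1$ be an integer. If a problem $(\mathcal{H},\mathcal{X})$ is $k$-neighborly, then it is $k$-split-neighborly.
   Context: Problem: a nonempty finite set $\mathcal{H}$ of hypotheses and a set $\mathcal{X}$ of tests, where each $h\in\mathcal{H}$ is a function $\mathcal{X}\to\{0,1\}$. Hypotheses are identifiable: any two distinct hypotheses give different results on at least one test. For a nonempty finite set $V$, $\mathbb{E}_{h\in V}[f(h)]=\frac{1}{|V|}\sum_{h\in V}f(h)$. For tests $x,x'$ let $\Delta(x,x')=\{h\in\mathcal{H}: h(x)=0 \wedge h(x')=1\}$. $k$-neighborly: the undirected graph on $\mathcal{X}$ with an edge $(x,x')$ whenever $|\Delta(x,x')\cup\Delta(x',x)|\le k$ is connected. Split-neighborly: for $\alpha\in(0,\frac12]$, define a directed graph on $\mathcal{X}$ with a directed edge $(x,x')$ iff for every $V\subseteq\Delta(x,x')$, either $|V|\le 1$ or there exists a test $\hat x\in\mathcal{X}$ with $\mathbb{E}_{h\in V}[h(\hat x)]\in[\alpha,1-\alpha]$. The problem is $\frac1\alpha$-split-neighborly if this graph is strongly connected. As a special case, the problem is $1$-split-neighborly if the directed graph with an edge $(x,x')$ whenever $|\Delta(x,x')|\le1$ is strongly connected. *)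

theory Defs
  imports Complex_Main "HOL-Library.FuncSet" "Graph_Theory.Graph_Theory"
begin

text \<open>
  The hypotheses are functions on a HOL type of which only the values on the set \<open>X\<close> of tests
  matter: two hypotheses that agree on \<open>X\<close> but differ outside are excluded by \<open>identifiable\<close>.
  The set \<open>X\<close> may be infinite.
\<close>

locale problem =
  fixes H :: "('x \<Rightarrow> nat) set" and X :: "'x set"
  assumes finite_H: "finite H"
    and nonempty_H: "H \<noteq> {}"
    and values_01: "H \<subseteq> X \<rightarrow> {0, 1}"
    and identifiable: "\<And>h h'. h \<in> H \<Longrightarrow> h' \<in> H \<Longrightarrow> h \<noteq> h' \<Longrightarrow> \<exists>x\<in>X. h x \<noteq> h' x"

definition mean :: "'a set \<Rightarrow> ('a \<Rightarrow> real) \<Rightarrow> real" where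
  "mean V f = (1 / real (card V)) * (\<Sum>h\<in>V. f h)"

definition Delta :: "('x \<Rightarrow> nat) set \<Rightarrow> 'x \<Rightarrow> 'x \<Rightarrow> ('x \<Rightarrow> nat) set" where
  "Delta H x x' = {h \<in> H. h x = 0 \<and> h x' = 1}"

text \<open>
  Graphs are represented by their vertex set and their set of ordered pairs (arcs); an undirected
  graph is a symmetric such digraph.  All graphs below contain the loops \<open>(x, x)\<close>, which do not
  affect connectivity.  In the library, \<open>connected\<close> and \<open>strongly_connected\<close> require a nonempty
  vertex set.
\<close>

definition neighborly_graph :: "('x \<Rightarrow> nat) set \<Rightarrow> 'x set \<Rightarrow> nat \<Rightarrow> 'x pair_pre_digraph" where
  "neighborly_graph H X k =
     \<lparr>pverts = X,
      parcs = {(x, x'). x \<in> X \<and> x' \<in> X \<and> card (Delta H x x' \<union> Delta H x' x) \<le> k}\<rparr>"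

definition neighborly :: "('x \<Rightarrow> nat) set \<Rightarrow> 'x set \<Rightarrow> nat \<Rightarrow> bool" where
  "neighborly H X k \<longleftrightarrow> Digraph_Component.connected (with_proj (neighborly_graph H X k))"

definition split_graph :: "('x \<Rightarrow> nat) set \<Rightarrow> 'x set \<Rightarrow> real \<Rightarrow> 'x pair_pre_digraph" where
  "split_graph H X \<alpha> =
     \<lparr>pverts = X,
      parcs = {(x, x'). x \<in> X \<and> x' \<in> X \<and>
        (\<forall>V. V \<subseteq> Delta H x x' \<longrightarrow>
           card V \<le> 1 \<or> (\<exists>t\<in>X. mean V (\<lambda>h. real (h t)) \<in> {\<alpha>..1 - \<alpha>}))}\<rparr>"

definition one_split_graph :: "('x \<Rightarrow> nat) set \<Rightarrow> 'x set \<Rightarrow> 'x pair_pre_digraph" where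
  "one_split_graph H X =
     \<lparr>pverts = X, parcs = {(x, x'). x \<in> X \<and> x' \<in> X \<and> card (Delta H x x') \<le> 1}\<rparr>"

text \<open>
  The parameter \<open>s\<close> stands for \<open>1/\<alpha>\<close>; the notion is meaningful only for \<open>s = 1\<close> (the special
  case) and \<open>s \<ge> 2\<close>, and the predicate is false for all other \<open>s\<close>.
\<close>

definition split_neighborly :: "('x \<Rightarrow> nat) set \<Rightarrow> 'x set \<Rightarrow> real \<Rightarrow> bool" where
  "split_neighborly H X s \<longleftrightarrow>
     (s = 1 \<and> strongly_connected (with_proj (one_split_graph H X))) \<or>
     (\<exists>\<alpha>. 0 < \<alpha> \<and> \<alpha> \<le> 1 / 2 \<and> s = 1 / \<alpha> \<and>
        strongly_connected (with_proj (split_graph H X \<alpha>)))"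

end

theory Submission
  imports Defs
begin

text \<open>
  Fix an edge of the neighborly graph and a set of \<open>n\<close> hypotheses inside \<open>\<Delta>\<close>, where
  \<open>2 \<le> n \<le> k\<close>.  By identifiability some test separates two of them, so its mean over the set
  is a multiple of \<open>1/n\<close> other than 0 and 1, hence lies in \<open>[1/n, 1 - 1/n] \<subseteq> [1/k, 1 - 1/k]\<close>.
  So every neighborly edge is, in both directions, an edge of the split graph.
\<close>

text \<open>The sum of \<open>f\<close> over \<open>V\<close> is a natural number: \<open>h\<close>
  makes it at least 1, and \<open>g\<close> makes it strictly less than \<open>card V\<close>, hence
  at most \<open>card V - 1\<close>. Dividing by \<open>card V\<close> gives both ends.\<close>

lemma mean_binary_bounds:
  fixes f :: "'a \<Rightarrow> nat"
  assumes "finite V" and f01: "f \<in> V \<rightarrow> {0, 1}"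
    and "g \<in> V" "f g = 0" "h \<in> V" "f h = 1"
  shows "mean V (\<lambda>v. real (f v)) \<in> {1 / real (card V)..1 - 1 / real (card V)}"
proof -
  have "f h \<le> sum f V"
    using \<open>finite V\<close> \<open>h \<in> V\<close> by (intro member_le_sum) auto
  then have lower: "1 \<le> sum f V" using \<open>f h = 1\<close> by simp
  have "sum f V < (\<Sum>v\<in>V. 1)"
    using \<open>finite V\<close> f01 \<open>g \<in> V\<close> \<open>f g = 0\<close>
    by (intro sum_strict_mono_ex1) (force simp: Pi_iff)+
  then have upper: "sum f V + 1 \<le> card V" by simp
  have "mean V (\<lambda>v. real (f v)) = real (sum f V) / real (card V)"
    by (simp add: mean_def)
  moreover have "real (sum f V) \<ge> 1" "real (sum f V) + 1 \<le> real (card V)"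
    using lower upper by linarith+
  ultimately show ?thesis
    by (simp add: field_simps)
qed

lemma (in problem) exists_splitting_test:
  assumes "V \<subseteq> H" and "2 \<le> card V" and "card V \<le> k"
  shows "\<exists>t\<in>X. mean V (\<lambda>h. real (h t)) \<in> {1 / real k..1 - 1 / real k}"
proof -
  have "finite V" using \<open>V \<subseteq> H\<close> finite_H by (rule finite_subset)
  obtain g h where gh: "g \<in> V" "h \<in> V" "g \<noteq> h"
    using \<open>2 \<le> card V\<close> card_le_Suc0_iff_eq[OF \<open>finite V\<close>] by fastforce
  then obtain t where t: "t \<in> X" "g t \<noteq> h t"
    using identifiable \<open>V \<subseteq> H\<close> by blast
  have val: "v t = 0 \<or> v t = 1" if "v \<in> V" for v
    using values_01 \<open>V \<subseteq> H\<close> \<open>t \<in> X\<close> that by (auto simp: Pi_iff dest!: subsetD)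
  then have "(\<lambda>v. v t) \<in> V \<rightarrow> {0, 1}" by auto
  \<comment> \<open>It is open which of the two takes the value 0; the bound on the mean applies
    with their roles in either order.\<close>
  moreover have "g t = 0 \<and> h t = 1 \<or> h t = 0 \<and> g t = 1"
    using val gh t by metis
  ultimately have "mean V (\<lambda>v. real (v t)) \<in> {1 / real (card V)..1 - 1 / real (card V)}"
    using mean_binary_bounds[OF \<open>finite V\<close>, of "\<lambda>v. v t"] gh by blast
  \<comment> \<open>This widens the interval to one that depends only on \<open>k\<close>, so that a
    single \<alpha> serves every \<open>V\<close>.\<close>
  moreover have "1 / real k \<le> 1 / real (card V)"
    using assms by (intro divide_left_mono) auto
  ultimately show ?thesis using \<open>t \<in> X\<close> by (intro bexI[of _ t]) auto
qed

text \<open>Adding arcs on the same vertices preserves every walk. This reduces the theorem to an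
  inclusion of arc sets.\<close>

lemma strongly_connected_with_proj_mono:
  assumes "strongly_connected (with_proj G)"
    and "pverts G = pverts G'" and "parcs G \<subseteq> parcs G'"
  shows "strongly_connected (with_proj G')"
  using assms rtrancl_on_mono[of "parcs G" "parcs G'" "pverts G" "pverts G'"]
  unfolding strongly_connected_def reachable_def by auto

text \<open>The library's \<open>connected\<close> symmetrizes the arcs first. Here this changes
  nothing, because the union of the two \<open>Delta\<close> sets is symmetric in the two
  tests.\<close>

lemma neighborly_iff_strongly_connected:
  "neighborly H X k \<longleftrightarrow> strongly_connected (with_proj (neighborly_graph H X k))"
proof -
  have "mk_symmetric (with_proj (neighborly_graph H X k)) = neighborly_graph H X k"
    by (auto simp: mk_symmetric_def neighborly_graph_def Un_commute)
  then show ?thesis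
    by (simp add: neighborly_def Digraph_Component.connected_def)
qed

theorem proposition3p1:
  fixes H :: "('x \<Rightarrow> nat) set" and X :: "'x set" and k :: nat
  assumes "problem H X"
    and "k \<ge> 1"
    and "neighborly H X k"
  shows "split_neighborly H X (real k)"
proof -
  interpret problem H X by fact
  have sc: "strongly_connected (with_proj (neighborly_graph H X k))"
    using assms(3) by (simp add: neighborly_iff_strongly_connected)
  have fin: "finite (Delta H x x')" for x x'
    using finite_H by (simp add: Delta_def)
  have card_le: "card V \<le> k"
    if "card (Delta H x x' \<union> Delta H x' x) \<le> k" "V \<subseteq> Delta H x x'" for V x x'
    using that card_mono[of "Delta H x x' \<union> Delta H x' x" V] fin by fastforce
  show ?thesis
  \<comment> \<open>For \<open>k = 1\<close> the value 1/k exceeds 1/2, so the special case of the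
    definition has to be met instead.\<close>
  proof (cases "k = 1")
    case True
    then have "parcs (neighborly_graph H X k) \<subseteq> parcs (one_split_graph H X)"
      using card_le[OF _ subset_refl] by (auto simp: neighborly_graph_def one_split_graph_def)
    then have "strongly_connected (with_proj (one_split_graph H X))"
      by (intro strongly_connected_with_proj_mono[OF sc])
        (auto simp: neighborly_graph_def one_split_graph_def)
    then show ?thesis by (simp add: split_neighborly_def True)
  next
    case False
    have "card V \<le> 1 \<or> (\<exists>t\<in>X. mean V (\<lambda>h. real (h t)) \<in> {1 / real k..1 - 1 / real k})"
      if "card (Delta H x x' \<union> Delta H x' x) \<le> k" "V \<subseteq> Delta H x x'" for V x x'
    proof -
      have "V \<subseteq> H" using that(2) by (auto simp: Delta_def)
      then show ?thesis
        using exists_splitting_test[of V k] card_le[OF that] by linarith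
    qed
    then have "parcs (neighborly_graph H X k) \<subseteq> parcs (split_graph H X (1 / real k))"
      by (auto simp: neighborly_graph_def split_graph_def simp del: atLeastAtMost_iff)
    then have "strongly_connected (with_proj (split_graph H X (1 / real k)))"
      by (intro strongly_connected_with_proj_mono[OF sc])
        (auto simp: neighborly_graph_def split_graph_def)
    \<comment> \<open>The witness \<alpha> = 1/k is admissible since now \<open>k\<close> is at
      least 2.\<close>
    moreover have "0 < 1 / real k" "1 / real k \<le> 1 / 2"
      using False \<open>k \<ge> 1\<close> by (auto simp: field_simps)
    ultimately show ?thesis
      unfolding split_neighborly_def by (intro disjI2 exI[of _ "1 / real k"]) simp
  qed
qed

end
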